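(* Let $\mathcal{L}$ be a Riesz space and $\mathcal{M}$ a Dedekind complete Riesz space. Let $(R_n)$ and $(T_n)$ be sequences in $\mathcal{L}_b(\mathcal{L},\mathcal{M})$ and $R,T\in\mathcal{L}_b(\mathcal{L},\mathcal{M})$ such that $(R_n)$ is statistically order convergent to $R$ and $(T_n)$ is statistically order convergent to $T$. Then the following hold: (i) $(|R_n|)$ is statistically order convergent to $|R|$; (ii) $(R_n\vee T_n)$ is statistically order convergent to $R\vee T$; (iii) $(R_n\wedge T_n)$ is statistically order convergent to $R\wedge T$.
   Context: All Riesz spaces (vector lattices) are real and Archimedean; $\theta$ denotes the zero element. "Operator" means linear map. An operator is order bounded if it maps order bounded sets to order bounded sets. $\mathcal{L}_b(\mathcal{L},\mathcal{M})$ is the space of order bounded operators $\mathcal{L}\to\mathcal{M}$, ordered by $S\le T$ iff $S(u)\le T(u)$ for all $u\in\mathcal{L}_+$. When $\mathcal{M}$ is Dedekind complete (every non-empty set bounded above has a supremum), $\mathcal{L}_b(\mathcal{L},\mathcal{M})$ is a Dedekind complete Riesz space; $\vee,\wedge,|\cdot|$ are taken in it. The natural density of $J\subseteq\mathbb{N}$ is $\delta(J)=\lim_{n\to\infty}\frac1n|\{j\in J: j\le n\}|$, when the limit exists. A sequence $(S_n)$ in $\mathcal{L}_b(\mathcal{L},\mathcal{M})$ is statistically order decreasing to $S\in\mathcal{L}_b(\mathcal{L},\mathcal{M})$ if there is $J\subseteq\mathbb{N}$ with $\delta(J)=1$ such that $S_m\le S_j$ for all $j<m$ in $J$ and $\inf_{j\in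 J}S_j=S$ in $\mathcal{L}_b(\mathcal{L},\mathcal{M})$. A sequence $(R_n)$ in $\mathcal{L}_b(\mathcal{L},\mathcal{M})$ is statistically order convergent to $R\in\mathcal{L}_b(\mathcal{L},\mathcal{M})$ if there exist a sequence $(S_n)$ in $\mathcal{L}_b(\mathcal{L},\mathcal{M})$ statistically order decreasing to $\theta$ and a set $J\subseteq\mathbb{N}$ with $\delta(J)=1$ such that $|R_j-R|\le S_j$ for all $j\in J$. *)

theory Defs
  imports Complex_Main "HOL-Library.Lattice_Algebras" "HOL-Library.Lub_Glb"
begin

section \<open>Riesz spaces\<close>

class archimedean_riesz_space = ordered_real_vector + lattice_ab_group_add +
  assumes archimedean: "\<lbrakk>0 \<le> v; \<And>n::nat. real n *\<^sub>R v \<le> u\<rbrakk> \<Longrightarrow> v = 0"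

text \<open>The axioms of \<^class>\<open>conditionally_complete_lattice\<close> say that every non-empty set that is
  bounded above (below) has a supremum (infimum), given by \<^const>\<open>Sup\<close> (\<^const>\<open>Inf\<close>).\<close>

class dedekind_complete_riesz_space = archimedean_riesz_space + conditionally_complete_lattice

section \<open>Order bounded operators\<close>

definition order_bounded_set :: "'a::order set \<Rightarrow> bool"
  where "order_bounded_set A \<longleftrightarrow> (\<exists>a b. A \<subseteq> {a..b})"

definition order_bounded_map :: "('a::order \<Rightarrow> 'b::order) \<Rightarrow> bool"
  where "order_bounded_map f \<longleftrightarrow> (\<forall>A. order_bounded_set A \<longrightarrow> order_bounded_set (f ` A))"

lemma order_bounded_mapI:
  fixes f :: "'a::order \<Rightarrow> 'b::order"
  assumes "\<And>a b. \<exists>c d. \<forall>x. a \<le> x \<longrightarrow> x \<le> b \<longrightarrow> c \<le> f x \<and> f x \<le> d"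
  shows "order_bounded_map f"
  unfolding order_bounded_map_def order_bounded_set_def
proof (intro allI impI)
  fix A :: "'a set" assume "\<exists>a b. A \<subseteq> {a..b}"
  then obtain a b where ab: "A \<subseteq> {a..b}" by blast
  obtain c d where "\<forall>x. a \<le> x \<longrightarrow> x \<le> b \<longrightarrow> c \<le> f x \<and> f x \<le> d"
    using assms by blast
  with ab have "f ` A \<subseteq> {c..d}" by fastforce
  then show "\<exists>a b. f ` A \<subseteq> {a..b}" by blast
qed

lemma order_bounded_mapE:
  fixes f :: "'a::order \<Rightarrow> 'b::order"
  assumes "order_bounded_map f"
  obtains c d where "\<And>x. a \<le> x \<Longrightarrow> x \<le> b \<Longrightarrow> c \<le> f x" "\<And>x. a \<le> x \<Longrightarrow> x \<le> b \<Longrightarrow> f x \<le> d"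
proof -
  have "order_bounded_set {a..b}"
    unfolding order_bounded_set_def by blast
  then have "order_bounded_set (f ` {a..b})"
    using assms unfolding order_bounded_map_def by blast
  then obtain c d where "f ` {a..b} \<subseteq> {c..d}"
    unfolding order_bounded_set_def by blast
  then have "c \<le> f x" "f x \<le> d" if "a \<le> x" "x \<le> b" for x
    using that by (auto simp: image_subset_iff)
  then show thesis using that by blast
qed

typedef (overloaded) ('a, 'b) ob_operator =
  "{f :: 'a::archimedean_riesz_space \<Rightarrow> 'b::archimedean_riesz_space. linear f \<and> order_bounded_map f}"
  morphisms ob_apply Ob_operator
proof
  show "(\<lambda>_. 0) \<in> {f :: 'a \<Rightarrow> 'b. linear f \<and> order_bounded_map f}"
    by (auto intro!: order_bounded_mapI linearI)
qed

setup_lifting type_definition_ob_operator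

lemma linear_ob_apply: "linear (ob_apply S)"
  using ob_apply by blast

lemma order_bounded_ob_apply: "order_bounded_map (ob_apply S)"
  using ob_apply by blast

lemma order_bounded_map_add:
  fixes f g :: "'a::archimedean_riesz_space \<Rightarrow> 'b::archimedean_riesz_space"
  assumes "order_bounded_map f" "order_bounded_map g"
  shows "order_bounded_map (\<lambda>x. f x + g x)"
proof (rule order_bounded_mapI)
  fix a b :: 'a
  obtain c d where f: "\<And>x. a \<le> x \<Longrightarrow> x \<le> b \<Longrightarrow> c \<le> f x" "\<And>x. a \<le> x \<Longrightarrow> x \<le> b \<Longrightarrow> f x \<le> d"
    using order_bounded_mapE[OF assms(1), of a b] by metis
  obtain c' d' where g: "\<And>x. a \<le> x \<Longrightarrow> x \<le> b \<Longrightarrow> c' \<le> g x" "\<And>x. a \<le> x \<Longrightarrow> x \<le> b \<Longrightarrow> g x \<le> d'"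
    using order_bounded_mapE[OF assms(2), of a b] by metis
  show "\<exists>c d. \<forall>x. a \<le> x \<longrightarrow> x \<le> b \<longrightarrow> c \<le> f x + g x \<and> f x + g x \<le> d"
    using f g by (intro exI[of _ "c + c'"] exI[of _ "d + d'"]) (auto intro: add_mono)
qed

lemma order_bounded_map_uminus:
  fixes f :: "'a::archimedean_riesz_space \<Rightarrow> 'b::archimedean_riesz_space"
  assumes "order_bounded_map f"
  shows "order_bounded_map (\<lambda>x. - f x)"
proof (rule order_bounded_mapI)
  fix a b :: 'a
  obtain c d where f: "\<And>x. a \<le> x \<Longrightarrow> x \<le> b \<Longrightarrow> c \<le> f x" "\<And>x. a \<le> x \<Longrightarrow> x \<le> b \<Longrightarrow> f x \<le> d"
    using order_bounded_mapE[OF assms(1), of a b] by metis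
  show "\<exists>c d. \<forall>x. a \<le> x \<longrightarrow> x \<le> b \<longrightarrow> c \<le> - f x \<and> - f x \<le> d"
    using f by (intro exI[of _ "- d"] exI[of _ "- c"]) auto
qed

lemma order_bounded_map_scaleR:
  fixes f :: "'a::archimedean_riesz_space \<Rightarrow> 'b::archimedean_riesz_space"
  assumes "order_bounded_map f"
  shows "order_bounded_map (\<lambda>x. r *\<^sub>R f x)"
proof (rule order_bounded_mapI)
  fix a b :: 'a
  obtain c d where f: "\<And>x. a \<le> x \<Longrightarrow> x \<le> b \<Longrightarrow> c \<le> f x" "\<And>x. a \<le> x \<Longrightarrow> x \<le> b \<Longrightarrow> f x \<le> d"
    using order_bounded_mapE[OF assms(1), of a b] by metis
  show "\<exists>c d. \<forall>x. a \<le> x \<longrightarrow> x \<le> b \<longrightarrow> c \<le> r *\<^sub>R f x \<and> r *\<^sub>R f x \<le> d"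
  proof (cases "0 \<le> r")
    case True
    then show ?thesis
      using f by (intro exI[of _ "r *\<^sub>R c"] exI[of _ "r *\<^sub>R d"]) (auto intro: scaleR_left_mono)
  next
    case False
    then show ?thesis
      using f by (intro exI[of _ "r *\<^sub>R d"] exI[of _ "r *\<^sub>R c"]) (auto intro: scaleR_left_mono_neg)
  qed
qed

lemma riesz_diff_nonneg:
  fixes x :: "'a::archimedean_riesz_space"
  obtains a b where "0 \<le> a" "0 \<le> b" "x = a - b"
proof
  show "0 \<le> pprt x" "0 \<le> - nprt x" by simp_all
  show "x = pprt x - - nprt x" using prts[of x] by simp
qed

instantiation ob_operator :: (archimedean_riesz_space, archimedean_riesz_space) ordered_real_vector
begin

lift_definition zero_ob_operator :: "('a, 'b) ob_operator" is "\<lambda>_. 0"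
  by (auto intro!: order_bounded_mapI linearI)

lift_definition plus_ob_operator ::
    "('a, 'b) ob_operator \<Rightarrow> ('a, 'b) ob_operator \<Rightarrow> ('a, 'b) ob_operator"
  is "\<lambda>f g x. f x + g x"
  by (auto intro: order_bounded_map_add linear_compose_add)

lift_definition uminus_ob_operator :: "('a, 'b) ob_operator \<Rightarrow> ('a, 'b) ob_operator"
  is "\<lambda>f x. - f x"
  by (auto intro: order_bounded_map_uminus linear_compose_neg)

lift_definition minus_ob_operator ::
    "('a, 'b) ob_operator \<Rightarrow> ('a, 'b) ob_operator \<Rightarrow> ('a, 'b) ob_operator"
  is "\<lambda>f g x. f x - g x"
  using order_bounded_map_add[OF _ order_bounded_map_uminus]
  by (auto intro: linear_compose_sub)

lift_definition scaleR_ob_operator :: "real \<Rightarrow> ('a, 'b) ob_operator \<Rightarrow> ('a, 'b) ob_operator"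
  is "\<lambda>r f x. r *\<^sub>R f x"
  by (auto intro: order_bounded_map_scaleR linear_compose_scale_right)

definition less_eq_ob_operator :: "('a, 'b) ob_operator \<Rightarrow> ('a, 'b) ob_operator \<Rightarrow> bool"
  where "S \<le> T \<longleftrightarrow> (\<forall>u\<ge>0. ob_apply S u \<le> ob_apply T u)"

definition less_ob_operator :: "('a, 'b) ob_operator \<Rightarrow> ('a, 'b) ob_operator \<Rightarrow> bool"
  where "S < T \<longleftrightarrow> S \<le> T \<and> \<not> T \<le> S" for S T :: "('a, 'b) ob_operator"

instance
proof
  fix S T U :: "('a, 'b) ob_operator" and r s :: real
  show "S + T + U = S + (T + U)" "S + T = T + S" "0 + S = S" "- S + S = 0" "S - T = S + - T"
    by (transfer, simp add: algebra_simps)+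
  show "r *\<^sub>R (S + T) = r *\<^sub>R S + r *\<^sub>R T" "(r + s) *\<^sub>R S = r *\<^sub>R S + s *\<^sub>R S"
    "r *\<^sub>R s *\<^sub>R S = (r * s) *\<^sub>R S" "1 *\<^sub>R S = S"
    by (transfer, simp add: algebra_simps)+
  show "S < T \<longleftrightarrow> S \<le> T \<and> \<not> T \<le> S"
    by (rule less_ob_operator_def)
  show "S \<le> S"
    by (simp add: less_eq_ob_operator_def)
  show "S \<le> U" if "S \<le> T" "T \<le> U"
    using that unfolding less_eq_ob_operator_def by (meson order_trans)
  show "S = T" if "S \<le> T" "T \<le> S"
  proof -
    have pos: "ob_apply S u = ob_apply T u" if "0 \<le> u" for u
      using \<open>S \<le> T\<close> \<open>T \<le> S\<close> that unfolding less_eq_ob_operator_def by (meson order_antisym)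
    have "ob_apply S x = ob_apply T x" for x
      by (rule riesz_diff_nonneg[of x]) (simp add: pos linear_diff[OF linear_ob_apply])
    then show ?thesis
      by (metis ob_apply_inject ext)
  qed
  show "U + S \<le> U + T" if "S \<le> T"
    using that by (simp add: less_eq_ob_operator_def plus_ob_operator.rep_eq)
  show "r *\<^sub>R S \<le> r *\<^sub>R T" if "S \<le> T" "0 \<le> r"
    using that by (simp add: less_eq_ob_operator_def scaleR_ob_operator.rep_eq scaleR_left_mono)
  show "r *\<^sub>R S \<le> s *\<^sub>R S" if "r \<le> s" "0 \<le> S"
    using that by (simp add: less_eq_ob_operator_def scaleR_ob_operator.rep_eq
        zero_ob_operator.rep_eq scaleR_right_mono)
qed

end

section \<open>The lattice of order bounded operators\<close>

text \<open>For a Dedekind complete codomain the positive part of an order bounded operator is given by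
  the Riesz--Kantorovich formula \<open>T\<^sup>+(u) = sup {T x | 0 \<le> x \<le> u}\<close> for \<open>u \<ge> 0\<close>.\<close>

definition rk_pos :: "('a::archimedean_riesz_space \<Rightarrow> 'b::dedekind_complete_riesz_space) \<Rightarrow> 'a \<Rightarrow> 'b"
  where "rk_pos f u = Sup (f ` {0..u})"

definition rk_ext :: "('a::archimedean_riesz_space \<Rightarrow> 'b::dedekind_complete_riesz_space) \<Rightarrow> 'a \<Rightarrow> 'b"
  where "rk_ext f x = rk_pos f (pprt x) - rk_pos f (- nprt x)"

context
  fixes f :: "'a::archimedean_riesz_space \<Rightarrow> 'b::dedekind_complete_riesz_space"
  assumes lin: "linear f" and ob: "order_bounded_map f"
begin

lemma rk_pos_upper: "0 \<le> x \<Longrightarrow> x \<le> u \<Longrightarrow> f x \<le> rk_pos f u"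
proof -
  assume x: "0 \<le> x" "x \<le> u"
  obtain c d where "\<And>x. 0 \<le> x \<Longrightarrow> x \<le> u \<Longrightarrow> c \<le> f x" "\<And>x. 0 \<le> x \<Longrightarrow> x \<le> u \<Longrightarrow> f x \<le> d"
    using order_bounded_mapE[OF ob, of 0 u] by metis
  then have "bdd_above (f ` {0..u})"
    by (auto intro!: bdd_aboveI)
  with x show ?thesis
    unfolding rk_pos_def by (auto intro: cSup_upper)
qed

lemma rk_pos_least: "0 \<le> u \<Longrightarrow> (\<And>x. 0 \<le> x \<Longrightarrow> x \<le> u \<Longrightarrow> f x \<le> y) \<Longrightarrow> rk_pos f u \<le> y"
  unfolding rk_pos_def by (rule cSup_least) auto

lemma rk_pos_nonneg: "0 \<le> u \<Longrightarrow> 0 \<le> rk_pos f u"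
  using rk_pos_upper[of 0 u] linear_0[OF lin] by simp

lemma rk_pos_zero: "rk_pos f 0 = 0"
  unfolding rk_pos_def by (simp add: linear_0[OF lin])

lemma rk_pos_add:
  assumes "0 \<le> u" "0 \<le> v"
  shows "rk_pos f (u + v) = rk_pos f u + rk_pos f v"
proof (rule order_antisym)
  show "rk_pos f (u + v) \<le> rk_pos f u + rk_pos f v"
  proof (rule rk_pos_least)
    fix z assume z: "0 \<le> z" "z \<le> u + v"
    have "f z = f (inf z u) + f (z - inf z u)"
      using linear_add[OF lin, of "inf z u" "z - inf z u"]
      by (simp only: add.commute[of "inf z u"] diff_add_cancel)
    moreover have "f (inf z u) \<le> rk_pos f u"
      using z assms by (intro rk_pos_upper) auto
    moreover have "z - inf z u \<le> v"
    proof -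
      have "z - v \<le> inf z u"
        using z assms by (simp add: diff_le_eq)
      then show ?thesis by (simp only: diff_le_eq add.commute)
    qed
    then have "f (z - inf z u) \<le> rk_pos f v"
      by (intro rk_pos_upper) (simp_all only: diff_ge_0_iff_ge inf_le1)
    ultimately show "f z \<le> rk_pos f u + rk_pos f v"
      by (simp add: add_mono)
  qed (use assms in simp)
next
  have "rk_pos f u \<le> rk_pos f (u + v) - rk_pos f v"
  proof (rule rk_pos_least)
    fix x assume x: "0 \<le> x" "x \<le> u"
    have "rk_pos f v \<le> rk_pos f (u + v) - f x"
    proof (rule rk_pos_least)
      fix y assume y: "0 \<le> y" "y \<le> v"
      have "f (x + y) \<le> rk_pos f (u + v)"
        using x y by (intro rk_pos_upper) (auto intro: add_mono)
      then show "f y \<le> rk_pos f (u + v) - f x"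
        by (simp add: linear_add[OF lin] algebra_simps)
    qed fact
    then show "f x \<le> rk_pos f (u + v) - rk_pos f v"
      by (simp add: algebra_simps)
  qed fact
  then show "rk_pos f u + rk_pos f v \<le> rk_pos f (u + v)"
    by (simp add: algebra_simps)
qed

lemma rk_pos_scaleR_le:
  assumes "0 < c" "0 \<le> u"
  shows "rk_pos f (c *\<^sub>R u) \<le> c *\<^sub>R rk_pos f u"
proof (rule rk_pos_least)
  fix x assume x: "0 \<le> x" "x \<le> c *\<^sub>R u"
  have "inverse c *\<^sub>R x \<le> inverse c *\<^sub>R c *\<^sub>R u"
    using x assms by (intro scaleR_left_mono) auto
  then have "f (inverse c *\<^sub>R x) \<le> rk_pos f u"
    using x assms by (intro rk_pos_upper) (auto intro: scaleR_nonneg_nonneg)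
  then have "c *\<^sub>R f (inverse c *\<^sub>R x) \<le> c *\<^sub>R rk_pos f u"
    using assms by (intro scaleR_left_mono) auto
  then show "f x \<le> c *\<^sub>R rk_pos f u"
    using assms by (simp add: linear_cmul[OF lin])
qed (use assms in \<open>auto intro: scaleR_nonneg_nonneg\<close>)

lemma rk_pos_scaleR:
  assumes "0 \<le> c" "0 \<le> u"
  shows "rk_pos f (c *\<^sub>R u) = c *\<^sub>R rk_pos f u"
proof (cases "c = 0")
  case True
  then show ?thesis by (simp add: rk_pos_zero)
next
  case False
  with assms have c: "0 < c" by simp
  have "rk_pos f (inverse c *\<^sub>R c *\<^sub>R u) \<le> inverse c *\<^sub>R rk_pos f (c *\<^sub>R u)"
    using c assms by (intro rk_pos_scaleR_le) (auto intro: scaleR_nonneg_nonneg)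
  then have "c *\<^sub>R rk_pos f u \<le> c *\<^sub>R inverse c *\<^sub>R rk_pos f (c *\<^sub>R u)"
    using c by (intro scaleR_left_mono) auto
  with rk_pos_scaleR_le[OF c assms(2)] show ?thesis
    using c by simp
qed

lemma rk_ext_diff:
  assumes "0 \<le> a" "0 \<le> b"
  shows "rk_ext f (a - b) = rk_pos f a - rk_pos f b"
proof -
  have "pprt (a - b) + b = a + - nprt (a - b)"
    using prts[of "a - b"] by (simp add: algebra_simps)
  then have "rk_pos f (pprt (a - b)) + rk_pos f b = rk_pos f a + rk_pos f (- nprt (a - b))"
    using assms rk_pos_add by (metis zero_le_pprt nprt_le_zero neg_0_le_iff_le)
  then show ?thesis
    unfolding rk_ext_def by (simp add: algebra_simps)
qed

lemma rk_ext_nonneg_arg: "0 \<le> u \<Longrightarrow> rk_ext f u = rk_pos f u"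
  using rk_ext_diff[of u 0] by (simp add: rk_pos_zero)

lemma linear_rk_ext: "linear (rk_ext f)"
proof (rule linearI)
  fix x y :: 'a and c :: real
  obtain a b where x: "0 \<le> a" "0 \<le> b" "x = a - b" by (rule riesz_diff_nonneg)
  obtain a' b' where y: "0 \<le> a'" "0 \<le> b'" "y = a' - b'" by (rule riesz_diff_nonneg)
  have "x + y = (a + a') - (b + b')"
    using x y by simp
  then show "rk_ext f (x + y) = rk_ext f x + rk_ext f y"
    using x y by (simp only: rk_ext_diff rk_pos_add add_nonneg_nonneg) simp
  show "rk_ext f (c *\<^sub>R x) = c *\<^sub>R rk_ext f x"
  proof (cases "0 \<le> c")
    case True
    then have "rk_ext f (c *\<^sub>R a - c *\<^sub>R b) = c *\<^sub>R (rk_pos f a - rk_pos f b)"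
      using x by (simp add: rk_ext_diff rk_pos_scaleR scaleR_nonneg_nonneg scaleR_diff_right)
    then show ?thesis
      using x by (simp add: rk_ext_diff scaleR_diff_right)
  next
    case False
    then have "rk_ext f ((- c) *\<^sub>R b - (- c) *\<^sub>R a) = (- c) *\<^sub>R (rk_pos f b - rk_pos f a)"
      using x rk_ext_diff[of "(- c) *\<^sub>R b" "(- c) *\<^sub>R a"] rk_pos_scaleR[of "- c"]
      by (simp add: scaleR_nonneg_nonneg scaleR_diff_right del: scaleR_minus_left)
    then show ?thesis
      using x by (simp add: rk_ext_diff scaleR_diff_right)
  qed
qed

lemma order_bounded_rk_ext: "order_bounded_map (rk_ext f)"
proof -
  have mono: "rk_ext f x \<le> rk_ext f y" if "x \<le> y" for x y
  proof -
    have "0 \<le> rk_ext f (y - x)"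
      using that by (simp add: rk_ext_nonneg_arg rk_pos_nonneg)
    then show ?thesis
      by (simp add: linear_diff[OF linear_rk_ext])
  qed
  show ?thesis
    by (rule order_bounded_mapI) (use mono in blast)
qed

end

lift_definition ob_pos ::
    "('a::archimedean_riesz_space, 'b::dedekind_complete_riesz_space) ob_operator
      \<Rightarrow> ('a, 'b) ob_operator" is rk_ext
  using linear_rk_ext order_bounded_rk_ext by blast

lemma ob_pos_apply: "0 \<le> u \<Longrightarrow> ob_apply (ob_pos S) u = Sup (ob_apply S ` {0..u})"
  using rk_ext_nonneg_arg[OF linear_ob_apply[of S] order_bounded_ob_apply[of S]]
  by (simp add: ob_pos.rep_eq flip: rk_pos_def)

lemma ob_pos_nonneg: "0 \<le> ob_pos S"
  using rk_pos_nonneg[OF linear_ob_apply[of S] order_bounded_ob_apply[of S]]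
  by (simp add: less_eq_ob_operator_def zero_ob_operator.rep_eq ob_pos_apply rk_pos_def)

lemma ob_pos_upper: "S \<le> ob_pos S"
  using rk_pos_upper[OF linear_ob_apply[of S] order_bounded_ob_apply[of S]]
  by (simp add: less_eq_ob_operator_def ob_pos_apply rk_pos_def)

lemma ob_pos_least:
  assumes "0 \<le> T" "S \<le> T"
  shows "ob_pos S \<le> T"
  unfolding less_eq_ob_operator_def
proof (intro allI impI)
  fix u :: 'a assume u: "0 \<le> u"
  have "rk_pos (ob_apply S) u \<le> ob_apply T u"
  proof (rule rk_pos_least[OF linear_ob_apply order_bounded_ob_apply u])
    fix x assume x: "0 \<le> x" "x \<le> u"
    have "ob_apply S x \<le> ob_apply T x"
      using assms x by (simp add: less_eq_ob_operator_def)
    also have "0 \<le> ob_apply T (u - x)"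
      using assms x by (simp add: less_eq_ob_operator_def zero_ob_operator.rep_eq)
    then have "ob_apply T x \<le> ob_apply T u"
      by (simp add: linear_diff[OF linear_ob_apply])
    finally show "ob_apply S x \<le> ob_apply T u" .
  qed
  with u show "ob_apply (ob_pos S) u \<le> ob_apply T u"
    by (simp add: ob_pos_apply rk_pos_def)
qed

instantiation ob_operator ::
  (archimedean_riesz_space, dedekind_complete_riesz_space) lattice_ab_group_add_abs
begin

definition sup_ob_operator ::
    "('a, 'b) ob_operator \<Rightarrow> ('a, 'b) ob_operator \<Rightarrow> ('a, 'b) ob_operator"
  where "sup S T = T + ob_pos (S - T)"

definition inf_ob_operator ::
    "('a, 'b) ob_operator \<Rightarrow> ('a, 'b) ob_operator \<Rightarrow> ('a, 'b) ob_operator"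
  where "inf S T = S - ob_pos (S - T)"

definition abs_ob_operator :: "('a, 'b) ob_operator \<Rightarrow> ('a, 'b) ob_operator"
  where "\<bar>S\<bar> = sup S (- S)" for S :: "('a, 'b) ob_operator"

instance
proof
  fix S T U :: "('a, 'b) ob_operator"
  show "S \<le> sup S T" "T \<le> sup S T"
    using ob_pos_upper[of "S - T"] ob_pos_nonneg[of "S - T"]
    by (simp_all add: sup_ob_operator_def algebra_simps)
  show "inf S T \<le> S" "inf S T \<le> T"
    using ob_pos_upper[of "S - T"] ob_pos_nonneg[of "S - T"]
    by (simp_all add: inf_ob_operator_def algebra_simps)
  show "sup S T \<le> U" if "S \<le> U" "T \<le> U"
    using that ob_pos_least[of "U - T" "S - T"]
    by (simp add: sup_ob_operator_def algebra_simps)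
  show "U \<le> inf S T" if "U \<le> S" "U \<le> T"
    using that ob_pos_least[of "S - U" "S - T"]
    by (simp add: inf_ob_operator_def algebra_simps)
  show "\<bar>S\<bar> = sup S (- S)"
    by (rule abs_ob_operator_def)
qed

end

instance ob_operator ::
  (archimedean_riesz_space, dedekind_complete_riesz_space) archimedean_riesz_space
proof
  fix V U :: "('a, 'b) ob_operator"
  assume V: "0 \<le> V" and le: "\<And>n::nat. real n *\<^sub>R V \<le> U"
  have "ob_apply V u = 0" if "0 \<le> u" for u
  proof (rule archimedean)
    show "0 \<le> ob_apply V u"
      using V that by (simp add: less_eq_ob_operator_def zero_ob_operator.rep_eq)
    show "real n *\<^sub>R ob_apply V u \<le> ob_apply U u" for n
      using le[of n] that by (simp add: less_eq_ob_operator_def scaleR_ob_operator.rep_eq)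
  qed
  then have "V \<le> 0"
    by (simp add: less_eq_ob_operator_def zero_ob_operator.rep_eq)
  with V show "V = 0" by simp
qed

section \<open>Statistical order convergence\<close>

text \<open>Whether \<open>0\<close> is counted among the indices is immaterial: it affects neither densities, nor
  the infimum of a family that decreases along an infinite index set.\<close>

definition has_natural_density :: "nat set \<Rightarrow> real \<Rightarrow> bool"
  where "has_natural_density J d \<longleftrightarrow> (\<lambda>n. real (card {j \<in> J. j \<le> n}) / real n) \<longlonglongrightarrow> d"

definition stat_order_decreasing ::
    "(nat \<Rightarrow> ('a::archimedean_riesz_space, 'b::dedekind_complete_riesz_space) ob_operator)
      \<Rightarrow> ('a, 'b) ob_operator \<Rightarrow> bool"
  where "stat_order_decreasing S S0 \<longleftrightarrow>
    (\<exists>J. has_natural_density J 1 \<and> (\<forall>j\<in>J. \<forall>m\<in>J. j < m \<longrightarrow> S m \<le> S j) \<and> isGlb UNIV (S ` J) S0)"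

definition stat_order_convergent ::
    "(nat \<Rightarrow> ('a::archimedean_riesz_space, 'b::dedekind_complete_riesz_space) ob_operator)
      \<Rightarrow> ('a, 'b) ob_operator \<Rightarrow> bool"
  where "stat_order_convergent R R0 \<longleftrightarrow>
    (\<exists>S J. stat_order_decreasing S 0 \<and> has_natural_density J 1 \<and> (\<forall>j\<in>J. \<bar>R j - R0\<bar> \<le> S j))"

end

theory Submission
  imports Defs
begin

text \<open>In any vector lattice the maps \<open>x \<mapsto> \<bar>x\<bar>\<close>, \<open>(x, y) \<mapsto> x \<squnion> y\<close> and \<open>(x, y) \<mapsto> x \<sqinter> y\<close> are Lipschitz for
  the absolute value: \<open>\<bar>\<bar>a\<bar> - \<bar>c\<bar>\<bar> \<le> \<bar>a - c\<bar>\<close>, and both \<open>\<bar>a \<squnion> b - c \<squnion> d\<bar>\<close> and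
  \<open>\<bar>a \<sqinter> b - c \<sqinter> d\<bar>\<close> are at most \<open>\<bar>a - c\<bar> + \<bar>b - d\<bar>\<close>. Hence a sequence that dominates \<open>\<bar>R n - R0\<bar>\<close> also
  dominates the error of the absolute values, and the sum of two dominating sequences dominates
  the errors of suprema and infima.

  What remains is that the sum of two sequences statistically order decreasing to \<open>0\<close> is again
  one (\<open>stat_order_decreasing_add\<close>). Two sets of density one meet in a set of density one
  (\<open>has_natural_density_1_Int\<close>), on which both sequences decrease; since that set is unbounded and the
  sequences are monotone, passing to it leaves the infimum unchanged.\<close>

text \<open>By inclusion-exclusion \<open>J \<inter> K\<close> misses at most what \<open>J\<close> and \<open>K\<close> miss separately, so its counting
  ratio lies between two sequences with limit one.\<close>

lemma has_natural_density_1_Int: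
  assumes J: "has_natural_density J 1" and K: "has_natural_density K 1"
  shows "has_natural_density (J \<inter> K) 1"
proof -
  define c where "c A n = real (card {j \<in> A. j \<le> n}) / real n" for A :: "nat set" and n
  have limJ: "c J \<longlonglongrightarrow> 1" and limK: "c K \<longlonglongrightarrow> 1"
    using J K unfolding has_natural_density_def c_def by auto
  have upper: "c (J \<inter> K) n \<le> c J n" for n
    unfolding c_def by (intro divide_right_mono of_nat_mono card_mono) auto
  have lower: "c J n + c K n - real (Suc n) / real n \<le> c (J \<inter> K) n" for n
  proof -
    let ?J = "{j \<in> J. j \<le> n}" and ?K = "{j \<in> K. j \<le> n}"
    have "card ?J + card ?K = card (?J \<union> ?K) + card (?J \<inter> ?K)"
      by (intro card_Un_Int) auto
    moreover have "card (?J \<union> ?K) \<le> card {..n}"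
      by (intro card_mono) auto
    moreover have "?J \<inter> ?K = {j \<in> J \<inter> K. j \<le> n}" by auto
    ultimately have "card ?J + card ?K \<le> Suc n + card {j \<in> J \<inter> K. j \<le> n}"
      by simp
    then have "real (card ?J) + real (card ?K) - real (Suc n) \<le> real (card {j \<in> J \<inter> K. j \<le> n})"
      by linarith
    then show ?thesis
      unfolding c_def add_divide_distrib[symmetric] diff_divide_distrib[symmetric]
      by (rule divide_right_mono) simp
  qed
  have "(\<lambda>n. c J n + c K n - real (Suc n) / real n) \<longlonglongrightarrow> 1 + 1 - 1"
    by (rule tendsto_diff[OF tendsto_add[OF limJ limK] LIMSEQ_Suc_n_over_n])
  then have lim: "(\<lambda>n. c J n + c K n - real (Suc n) / real n) \<longlonglongrightarrow> 1"
    by simp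
  have "c (J \<inter> K) \<longlonglongrightarrow> 1"
    by (rule tendsto_sandwich[OF always_eventually always_eventually lim limJ])
      (intro allI lower upper)+
  then show ?thesis
    unfolding has_natural_density_def c_def .
qed

lemma has_natural_density_1_unbounded:
  assumes "has_natural_density J 1"
  obtains j where "j \<in> J" "k < j"
proof (rule ccontr)
  assume "\<not> thesis"
  with that have bound: "j \<le> k" if "j \<in> J" for j
    using \<open>j \<in> J\<close> by (meson not_le)
  have le: "real (card {j \<in> J. j \<le> n}) / real n \<le> real (Suc k) / real n" for n
  proof -
    have "card {j \<in> J. j \<le> n} \<le> card {..k}"
      using bound by (intro card_mono) auto
    then show ?thesis by (intro divide_right_mono) auto
  qed
  have "(\<lambda>n. real (card {j \<in> J. j \<le> n}) / real n) \<longlonglongrightarrow> 0"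
    by (rule tendsto_sandwich[OF _ _ tendsto_const lim_const_over_n[of "real (Suc k)"]]) (use le in auto)
  from LIMSEQ_unique[OF this assms[unfolded has_natural_density_def]] show False by simp
qed

text \<open>A lower bound \<open>L\<close> of \<open>S j + T j\<close> along the common index set is also a lower bound of all
  mixed sums \<open>S i + T k\<close>, because some later common index lies below both terms; the two indices can
  then be varied separately, which yields \<open>L \<le> 0\<close>.\<close>

lemma stat_order_decreasing_add:
  assumes "stat_order_decreasing S 0" "stat_order_decreasing T 0"
  shows "stat_order_decreasing (\<lambda>n. S n + T n) 0"
proof -
  obtain J where J: "has_natural_density J 1" "\<And>i j. i \<in> J \<Longrightarrow> j \<in> J \<Longrightarrow> i < j \<Longrightarrow> S j \<le> S i"
    and infS: "isGlb UNIV (S ` J) 0"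
    using assms(1) unfolding stat_order_decreasing_def by blast
  obtain K where K: "has_natural_density K 1" "\<And>i j. i \<in> K \<Longrightarrow> j \<in> K \<Longrightarrow> i < j \<Longrightarrow> T j \<le> T i"
    and infT: "isGlb UNIV (T ` K) 0"
    using assms(2) unfolding stat_order_decreasing_def by blast
  have S_ge: "0 \<le> S j" if "j \<in> J" for j
    using infS that by (auto simp: isGlb_def isLb_def greatestP_def setge_def)
  have T_ge: "0 \<le> T k" if "k \<in> K" for k
    using infT that by (auto simp: isGlb_def isLb_def greatestP_def setge_def)
  have S_great: "L \<le> 0" if "\<And>j. j \<in> J \<Longrightarrow> L \<le> S j" for L
    using infS that by (auto simp: isGlb_def isLb_def greatestP_def setge_def setle_def)
  have T_great: "L \<le> 0" if "\<And>k. k \<in> K \<Longrightarrow> L \<le> T k" for L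
    using infT that by (auto simp: isGlb_def isLb_def greatestP_def setge_def setle_def)
  have JK: "has_natural_density (J \<inter> K) 1"
    by (intro has_natural_density_1_Int J K)
  have great: "L \<le> 0" if L: "\<And>n. n \<in> J \<inter> K \<Longrightarrow> L \<le> S n + T n" for L
  proof (rule T_great)
    fix k assume k: "k \<in> K"
    have "L - T k \<le> 0"
    proof (rule S_great)
      fix j assume j: "j \<in> J"
      obtain n where n: "n \<in> J \<inter> K" "max j k < n"
        using has_natural_density_1_unbounded[OF JK] .
      have "L \<le> S n + T n" by (rule L) fact
      also have "\<dots> \<le> S j + T k"
        using n j k by (intro add_mono J K) auto
      finally show "L - T k \<le> S j" by (simp add: diff_le_eq)
    qed
    then show "L \<le> T k" by simp
  qed
  have "isGlb UNIV ((\<lambda>n. S n + T n) ` (J \<inter> K)) 0"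
    using S_ge T_ge great by (auto simp: isGlb_def isLb_def greatestP_def setge_def setle_def)
  moreover have "\<forall>i\<in>J \<inter> K. \<forall>j\<in>J \<inter> K. i < j \<longrightarrow> S j + T j \<le> S i + T i"
    using J(2) K(2) by (auto intro: add_mono)
  ultimately show ?thesis
    unfolding stat_order_decreasing_def using JK by blast
qed

lemma stat_order_convergent_dominated:
  assumes "stat_order_convergent R R0" and "\<And>n. \<bar>Q n - Q0\<bar> \<le> \<bar>R n - R0\<bar>"
  shows "stat_order_convergent Q Q0"
proof -
  obtain S J where S: "stat_order_decreasing S 0" "has_natural_density J 1"
    "\<And>j. j \<in> J \<Longrightarrow> \<bar>R j - R0\<bar> \<le> S j"
    using assms(1) unfolding stat_order_convergent_def by blast
  have "\<bar>Q j - Q0\<bar> \<le> S j" if "j \<in> J" for j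
    using assms(2) S(3)[OF that] by (rule order_trans)
  with S(1,2) show ?thesis
    unfolding stat_order_convergent_def by blast
qed

lemma stat_order_convergent_dominated_add:
  assumes "stat_order_convergent R R0" "stat_order_convergent T T0"
    and dom: "\<And>n. \<bar>Q n - Q0\<bar> \<le> \<bar>R n - R0\<bar> + \<bar>T n - T0\<bar>"
  shows "stat_order_convergent Q Q0"
proof -
  obtain S J where S: "stat_order_decreasing S 0" "has_natural_density J 1"
    "\<And>j. j \<in> J \<Longrightarrow> \<bar>R j - R0\<bar> \<le> S j"
    using assms(1) unfolding stat_order_convergent_def by blast
  obtain S' K where S': "stat_order_decreasing S' 0" "has_natural_density K 1"
    "\<And>j. j \<in> K \<Longrightarrow> \<bar>T j - T0\<bar> \<le> S' j"
    using assms(2) unfolding stat_order_convergent_def by blast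
  have "\<bar>Q j - Q0\<bar> \<le> S j + S' j" if "j \<in> J \<inter> K" for j
    using that by (intro order_trans[OF dom] add_mono S S') auto
  then show ?thesis
    unfolding stat_order_convergent_def
    using stat_order_decreasing_add[OF S(1) S'(1)] has_natural_density_1_Int[OF S(2) S'(2)] by blast
qed

text \<open>Moving \<open>a\<close> to \<open>c\<close> and \<open>b\<close> to \<open>d\<close> costs at most \<open>\<bar>a - c\<bar>\<close> and \<open>\<bar>b - d\<bar>\<close>; the bound is symmetric under
  exchanging the two pairs, so the one-sided estimate is enough.\<close>

lemma abs_sup_diff_le:
  fixes a b c d :: "'a::lattice_ab_group_add_abs"
  shows "\<bar>sup a b - sup c d\<bar> \<le> \<bar>a - c\<bar> + \<bar>b - d\<bar>"
proof -
  have le: "sup a b \<le> \<bar>a - c\<bar> + \<bar>b - d\<bar> + sup c d" for a b c d :: 'a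
  proof (rule sup_least)
    have "a - c \<le> \<bar>a - c\<bar> + \<bar>b - d\<bar>"
      using add_mono[OF abs_ge_self[of "a - c"] abs_ge_zero[of "b - d"]] by simp
    then have "a \<le> \<bar>a - c\<bar> + \<bar>b - d\<bar> + c" by (simp only: diff_le_eq)
    also have "\<dots> \<le> \<bar>a - c\<bar> + \<bar>b - d\<bar> + sup c d" by (intro add_left_mono sup_ge1)
    finally show "a \<le> \<bar>a - c\<bar> + \<bar>b - d\<bar> + sup c d" .
    have "b - d \<le> \<bar>a - c\<bar> + \<bar>b - d\<bar>"
      using add_mono[OF abs_ge_zero[of "a - c"] abs_ge_self[of "b - d"]] by simp
    then have "b \<le> \<bar>a - c\<bar> + \<bar>b - d\<bar> + d" by (simp only: diff_le_eq)
    also have "\<dots> \<le> \<bar>a - c\<bar> + \<bar>b - d\<bar> + sup c d" by (intro add_left_mono sup_ge2)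
    finally show "b \<le> \<bar>a - c\<bar> + \<bar>b - d\<bar> + sup c d" .
  qed
  show ?thesis
  proof (rule abs_leI)
    show "sup a b - sup c d \<le> \<bar>a - c\<bar> + \<bar>b - d\<bar>"
      using le[of a b c d] by (simp only: diff_le_eq)
    show "- (sup a b - sup c d) \<le> \<bar>a - c\<bar> + \<bar>b - d\<bar>"
      using le[of c d a b] by (simp only: minus_diff_eq diff_le_eq abs_minus_commute)
  qed
qed

lemma abs_inf_diff_le:
  fixes a b c d :: "'a::lattice_ab_group_add_abs"
  shows "\<bar>inf a b - inf c d\<bar> \<le> \<bar>a - c\<bar> + \<bar>b - d\<bar>"
  using abs_sup_diff_le[of "- a" "- b" "- c" "- d"]
  by (simp only: inf_eq_neg_sup minus_diff_minus abs_minus_cancel)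

theorem theorem3p5:
  fixes R T :: "nat \<Rightarrow> ('a::archimedean_riesz_space, 'b::dedekind_complete_riesz_space) ob_operator"
    and R0 T0 :: "('a, 'b) ob_operator"
  assumes "stat_order_convergent R R0"
    and "stat_order_convergent T T0"
  shows "stat_order_convergent (\<lambda>n. \<bar>R n\<bar>) \<bar>R0\<bar>
    \<and> stat_order_convergent (\<lambda>n. sup (R n) (T n)) (sup R0 T0)
    \<and> stat_order_convergent (\<lambda>n. inf (R n) (T n)) (inf R0 T0)"
proof (intro conjI)
  show "stat_order_convergent (\<lambda>n. \<bar>R n\<bar>) \<bar>R0\<bar>"
    using assms(1) by (rule stat_order_convergent_dominated) (rule abs_triangle_ineq3)
  show "stat_order_convergent (\<lambda>n. sup (R n) (T n)) (sup R0 T0)"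
    using assms by (rule stat_order_convergent_dominated_add) (rule abs_sup_diff_le)
  show "stat_order_convergent (\<lambda>n. inf (R n) (T n)) (inf R0 T0)"
    using assms by (rule stat_order_convergent_dominated_add) (rule abs_inf_diff_le)
qed

end
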